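(* For every $n\ge 0$, the number $r_n$ of Rota-Baxter words of degree $n$ in the set $R$ (the canonical basis of the free Rota-Baxter algebra with a single idempotent generator and an idempotent operator) is $$r_n=2^{n+1}C_n,\qquad C_n=\frac{1}{n+1}\binom{2n}{n}.$$
   Context: Words are finite strings over the three symbols $x,\lfloor,\rfloor$. Let $R$ be the set consisting of the empty word $\emptyset$ together with all nonempty strings $w$ such that: (i) $w$ has equally many $\lfloor$ and $\rfloor$, and every prefix of $w$ has at least as many $\lfloor$ as $\rfloor$ (so brackets are balanced and matched into pairs in the usual way); (ii) no two $x$'s are adjacent in $w$; (iii) neither $\rfloor\lfloor$ nor $\lfloor\rfloor$ occurs as a substring of $w$; (iv) no two matched pairs of brackets are immediately nested, i.e. no substring $\lfloor\lfloor w'\rfloor\rfloor$ occurs in which the first $\lfloor$ is matched with the last $\rfloor$ and the second $\lfloor$ with the second-to-last $\rfloor$. Elements of $R$ are called Rota-Baxter words; the degree of a word is its number of matched pairs of brackets. So the degree-$0$ words are $\emptyset$ and $x$. *)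

theory Defs
  imports Complex_Main "HOL-Library.Sublist"
begin

datatype letter = X | LB | RB  \<comment> \<open>the symbols \<open>x\<close>, \<open>\<lfloor>\<close> and \<open>\<rfloor>\<close>\<close>

type_synonym word = "letter list"

definition balanced :: "word \<Rightarrow> bool" where
  "balanced w \<longleftrightarrow>
     count_list w LB = count_list w RB \<and>
     (\<forall>u. prefix u w \<longrightarrow> count_list u RB \<le> count_list u LB)"

text \<open>
  In a balanced word, the bracket \<open>\<rfloor>\<close> matched with the bracket \<open>\<lfloor>\<close> at position \<open>i\<close> is the
  one at the unique position \<open>j > i\<close> such that the factor strictly between the positions
  \<open>i\<close> and \<open>j\<close> is itself balanced.
\<close>

definition matched :: "word \<Rightarrow> nat \<Rightarrow> nat \<Rightarrow> bool" where
  "matched w i j \<longleftrightarrow>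
     i < j \<and> j < length w \<and> w ! i = LB \<and> w ! j = RB \<and>
     balanced (take (j - Suc i) (drop (Suc i) w))"

definition degree :: "word \<Rightarrow> nat" where
  "degree w = card {(i, j). matched w i j}"

definition rota_baxter_words :: "word set" where
  "rota_baxter_words =
     {[]} \<union>
     {w. w \<noteq> [] \<and>
         balanced w \<and>
         \<not> sublist [X, X] w \<and>
         \<not> sublist [RB, LB] w \<and> \<not> sublist [LB, RB] w \<and>
         \<not> (\<exists>i j. matched w i j \<and> matched w (i + 1) (j - 1))}"

end

theory Submission
  imports Defs "HOL-Computational_Algebra.Formal_Power_Series"
begin

text \<open>
  Write \<open>R\<close> for the set of Rota-Baxter words, \<open>Q\<close> for those that do not start with \<open>x\<close>, and \<open>P\<close>
  for those of the form \<open>\<lfloor>u\<rfloor>\<close> with the two outer brackets matched. Removing a leading \<open>x\<close> from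
  a word and cutting the rest behind the partner of its first bracket shows that
  \<^item> every word of \<open>R\<close> is a word of \<open>Q\<close>, possibly preceded by \<open>x\<close>;
  \<^item> every word of \<open>Q\<close> is empty, or lies in \<open>P\<close>, or is \<open>p x q\<close> with \<open>p \<in> P\<close> and \<open>q \<in> Q\<close>:
    after a closing bracket only \<open>x\<close> can follow at the same nesting level;
  \<^item> \<open>\<lfloor>u\<rfloor>\<close> is in \<open>P\<close> precisely if \<open>u\<close> is a nonempty word of \<open>R\<close> outside \<open>P\<close>, since
    \<open>\<lfloor>\<rfloor>\<close> and immediately nested pairs are forbidden.

  Each of these descriptions is unambiguous because the partner of a bracket is unique, so with the
  same letters for the generating functions by degree and \<open>z\<close> for the indeterminate,
  \<open>R = 2Q\<close>, \<open>Q = 1 + P + PQ\<close> and \<open>P = z (R - 1 - P)\<close>. Eliminating \<open>P\<close> and \<open>R\<close> leaves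
  \<open>Q = 1 + 2zQ\<^sup>2\<close>, the equation of the Catalan generating function at \<open>2z\<close>. Hence \<open>Q\<close> has the
  coefficients \<open>2\<^sup>n C\<^sub>n\<close>, and \<open>R\<close> has twice these.

  The definition of \<open>R\<close> refers to positions of matched brackets. To make the cutting argument
  formal, it is first replaced by an equivalent description through factors of words
  (\<open>rota_baxter_words_alt\<close>); the degree becomes the number of opening brackets
  (\<open>degree_eq_count\<close>).
\<close>

unbundle fps_syntax

section \<open>Balanced words and matched brackets\<close>

lemma balancedD:
  assumes "balanced w" "w = u @ v"
  shows "count_list u RB \<le> count_list u LB" "count_list v LB \<le> count_list v RB"
proof -
  have "prefix u w" using assms(2) by simp
  then show 1: "count_list u RB \<le> count_list u LB"
    using assms(1) by (simp add: balanced_def)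
  have "count_list w LB = count_list w RB" using assms(1) by (simp add: balanced_def)
  then show "count_list v LB \<le> count_list v RB"
    using 1 assms(2) by simp
qed

lemma balanced_count: "balanced w \<Longrightarrow> count_list w LB = count_list w RB"
  by (simp add: balanced_def)

lemma balanced_Nil [simp]: "balanced []"
  by (simp add: balanced_def)

lemma balanced_append: "balanced u \<Longrightarrow> balanced v \<Longrightarrow> balanced (u @ v)"
  by (auto simp: balanced_def prefix_append)

lemma balanced_append_cancel:
  assumes "balanced u" "balanced (u @ v)"
  shows "balanced v"
  unfolding balanced_def
proof (intro conjI allI impI)
  show "count_list v LB = count_list v RB"
    using balanced_count[OF assms(1)] balanced_count[OF assms(2)] by simp
next
  fix p assume "prefix p v"
  then obtain s where "u @ v = (u @ p) @ s" by (auto simp: prefix_def)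
  from balancedD(1)[OF assms(2) this] show "count_list p RB \<le> count_list p LB"
    using balanced_count[OF assms(1)] by simp
qed

lemma balanced_X: "balanced [X]"
  by (auto simp: balanced_def prefix_Cons)

lemma balanced_Cons_X [simp]: "balanced (X # w) \<longleftrightarrow> balanced w"
  using balanced_append[OF balanced_X, of w] balanced_append_cancel[OF balanced_X, of w] by auto

definition bracket :: "word \<Rightarrow> word" where
  "bracket u = LB # u @ [RB]"

lemma balanced_bracket: "balanced u \<Longrightarrow> balanced (bracket u)"
  by (fastforce simp: balanced_def bracket_def prefix_Cons prefix_append)

text \<open>
  The shortest prefix with more closing than opening brackets ends in a closing bracket, and what
  precedes that bracket is balanced. This finds the partner of an opening bracket that stands
  just before \<open>s\<close>.
\<close>

lemma first_return:
  "count_list s LB < count_list s RB \<Longrightarrow> \<exists>m t. s = m @ RB # t \<and> balanced m"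
proof (induction s rule: measure_induct_rule[of length])
  case (less s)
  show ?case
  proof (cases "\<exists>p t. s = p @ t \<and> t \<noteq> [] \<and> count_list p LB < count_list p RB")
    case True
    then obtain p t where "s = p @ t" "length p < length s" "count_list p LB < count_list p RB"
      by auto
    then obtain m t' where "s = m @ RB # (t' @ t)" "balanced m"
      using less.IH[of p] by auto
    then show ?thesis by blast
  next
    case False
    from less.prems obtain m a where s: "s = m @ [a]"
      by (cases s rule: rev_cases) auto
    have le: "count_list p RB \<le> count_list p LB" if "prefix p m" for p
      using False that s by (fastforce simp: prefix_def not_less)
    have "a = RB" "count_list m LB = count_list m RB"
      using less.prems le[of m] s by (auto split: if_splits)
    with le s have "s = m @ RB # [] \<and> balanced m" by (simp add: balanced_def)
    then show ?thesis by blast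
  qed
qed

text \<open>
  If one of the balanced words were a proper prefix of the other, then the longer one would have
  a prefix that ends in the unmatched closing bracket.
\<close>

lemma first_return_unique:
  assumes "balanced m" "balanced m'" "m @ RB # s = m' @ RB # s'"
  shows "m = m' \<and> s = s'"
proof -
  have *: "us = []" if h: "balanced a" "a = b @ us" "us @ RB # c = RB # d" "balanced b" for a b us c d
  proof (rule ccontr)
    assume "us \<noteq> []"
    then obtain us' where "a = (b @ [RB]) @ us'" using h by (cases us) auto
    from balancedD(1)[OF h(1) this] balanced_count[OF h(4)] show False by simp
  qed
  from assms(3) obtain us where
    us: "m = m' @ us \<and> us @ RB # s = RB # s' \<or> m @ us = m' \<and> RB # s = us @ RB # s'"
    unfolding append_eq_append_conv2 by blast
  from this have "us = []" using *[of m m' us s s'] *[of m' m us s' s] assms(1,2) by fastforce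
  with us have "m = m'" by auto
  with assms(3) show ?thesis by simp
qed

lemma bracket_append_inject:
  assumes "balanced u" "balanced v" "bracket u @ s = bracket v @ t"
  shows "u = v \<and> s = t"
  using first_return_unique[of u v s t] assms by (simp add: bracket_def)

text \<open>
  Matched pairs are occurrences of factors \<open>\<lfloor>m\<rfloor>\<close> with \<open>m\<close> balanced, which allows
  the positions to be forgotten.
\<close>

lemma matched_iff:
  "matched w i j \<longleftrightarrow>
     (\<exists>p m s. w = p @ bracket m @ s \<and> balanced m \<and> i = length p \<and> j = Suc (i + length m))"
proof
  assume m: "matched w i j"
  define p where "p = take i w"
  define m where "m = take (j - Suc i) (drop (Suc i) w)"
  define s where "s = drop (Suc j) w"
  have ij: "i < j" "j < length w" "w ! i = LB" "w ! j = RB" "balanced m"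
    using m by (auto simp: matched_def m_def)
  have "w = p @ LB # drop (Suc i) w"
    using id_take_nth_drop[of i w] ij by (simp add: p_def)
  also have "drop (Suc i) w = m @ drop j w"
    using ij by (metis m_def append_take_drop_id drop_drop Suc_leI le_add_diff_inverse2)
  also have "drop j w = RB # s"
    using ij by (simp add: s_def Cons_nth_drop_Suc flip: ij(4))
  finally have "w = p @ bracket m @ s" by (simp add: bracket_def)
  moreover have "i = length p" "j = Suc (i + length m)"
    using ij by (auto simp: p_def m_def)
  ultimately show "\<exists>p m s. w = p @ bracket m @ s \<and> balanced m \<and> i = length p \<and>
      j = Suc (i + length m)" using ij by blast
next
  assume "\<exists>p m s. w = p @ bracket m @ s \<and> balanced m \<and> i = length p \<and> j = Suc (i + length m)"
  then show "matched w i j" by (auto simp: matched_def bracket_def nth_append)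
qed

definition nested :: "word \<Rightarrow> bool" where
  "nested w \<longleftrightarrow> (\<exists>p m s. w = p @ bracket (bracket m) @ s \<and> balanced m)"

lemma nested_iff_matched:
  "nested w \<longleftrightarrow> (\<exists>i j. matched w i j \<and> matched w (i + 1) (j - 1))"
proof
  assume "nested w"
  then obtain p m s where w: "w = p @ bracket (bracket m) @ s" "balanced m"
    by (auto simp: nested_def)
  have "matched w (length p) (Suc (length p + length (bracket m)))"
    using w balanced_bracket unfolding matched_iff by blast
  moreover have "matched w (length p + 1) (length p + length (bracket m))"
    unfolding matched_iff
    by (rule exI[of _ "p @ [LB]"], rule exI[of _ m], rule exI[of _ "RB # s"])
      (use w in \<open>simp add: bracket_def\<close>)
  ultimately show "\<exists>i j. matched w i j \<and> matched w (i + 1) (j - 1)"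
    by (metis diff_Suc_1)
next
  assume "\<exists>i j. matched w i j \<and> matched w (i + 1) (j - 1)"
  then obtain p m s p' m' s' where
    w: "w = p @ bracket m @ s" and w': "w = p' @ bracket m' @ s'" "balanced m'"
    and len: "length p' = length p + 1" "length m = length m' + 2"
    unfolding matched_iff by (clarsimp, metis)
  have "p @ LB # (m @ RB # s) = (p' @ [LB]) @ (m' @ RB # s')"
    using w w' by (simp add: bracket_def)
  moreover have "p' = p @ [LB]"
    using w w' len
    by (metis (no_types, lifting) append_eq_append_conv append.assoc append_Cons append_Nil
        bracket_def length_append_singleton Suc_eq_plus1)
  ultimately have "m @ RB # s = bracket m' @ s'"
    using w w' by (simp add: bracket_def)
  moreover have "length m = length (bracket m')"
    using len by (simp add: bracket_def)
  ultimately have "m = bracket m'"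
    by (metis append_eq_append_conv)
  with w w' show "nested w" by (auto simp: nested_def)
qed

text \<open>
  Every opening bracket of a balanced word has exactly one partner, so sending a matched pair to
  the position of its opening bracket is a bijection.
\<close>

lemma degree_eq_count:
  assumes "balanced w"
  shows "degree w = count_list w LB"
proof -
  have "j = k" if "matched w i j" "matched w i k" for i j k
  proof -
    from that obtain p m s p' m' s' where
      "w = p @ bracket m @ s" "w = p' @ bracket m' @ s'" "length p = length p'"
      "balanced m" "balanced m'" "j = Suc (i + length m)" "k = Suc (i + length m')"
      unfolding matched_iff by metis
    then show ?thesis using bracket_append_inject[of m m' s s'] by simp
  qed
  then have "inj_on fst {(i, j). matched w i j}" by (auto simp: inj_on_def)
  then have "degree w = card (fst ` {(i, j). matched w i j})"
    by (simp add: degree_def card_image)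
  also have "fst ` {(i, j). matched w i j} = {i. i < length w \<and> LB = w ! i}"
  proof (intro equalityI subsetI)
    fix i assume "i \<in> {i. i < length w \<and> LB = w ! i}"
    then have "i < length w" "w ! i = LB" by simp_all
    then obtain p r where w: "w = p @ LB # r" and i: "i = length p"
      by (metis id_take_nth_drop length_take min.absorb4)
    have "count_list r LB < count_list r RB"
      using balancedD(2)[OF assms w] by simp
    then obtain m s where "r = m @ RB # s" "balanced m"
      using first_return by blast
    then have "w = p @ bracket m @ s" using w by (simp add: bracket_def)
    then have "matched w i (Suc (i + length m))"
      unfolding matched_iff using i \<open>balanced m\<close> by blast
    then show "i \<in> fst ` {(i, j). matched w i j}" by force
  qed (auto simp: matched_def)
  finally show ?thesis
    by (simp add: count_list_eq_length_filter length_filter_conv_card)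
qed

section \<open>Rota-Baxter words in terms of factors\<close>

definition admissible :: "letter \<Rightarrow> letter \<Rightarrow> bool" where
  "admissible a b \<longleftrightarrow> (a, b) \<notin> {(X, X), (RB, LB), (LB, RB)}"

lemma successively_iff_sublist:
  "successively P w \<longleftrightarrow> (\<forall>a b. sublist [a, b] w \<longrightarrow> P a b)"
proof (induction w)
  case (Cons x w)
  have *: "sublist [a, b] (x # w) \<longleftrightarrow> (a = x \<and> w \<noteq> [] \<and> hd w = b) \<or> sublist [a, b] w" for a b
    unfolding sublist_Cons_right by (cases w) auto
  show ?case unfolding successively_Cons Cons.IH * by (cases "w = []") auto
qed simp

lemma rota_baxter_words_alt:
  "rota_baxter_words = {w. balanced w \<and> successively admissible w \<and> \<not> nested w}"
proof -
  have "successively admissible w \<longleftrightarrow>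
      \<not> sublist [X, X] w \<and> \<not> sublist [RB, LB] w \<and> \<not> sublist [LB, RB] w" for w
    unfolding successively_iff_sublist by (simp add: admissible_def) blast
  moreover have "\<not> nested []" by (simp add: nested_def bracket_def)
  ultimately show ?thesis
    unfolding rota_baxter_words_def nested_iff_matched[symmetric] set_eq_iff by fastforce
qed

text \<open>
  A factor \<open>\<lfloor>m\<rfloor>\<close> cannot straddle the end of a balanced word \<open>a\<close>: the part of it
  at the end of \<open>a\<close> would have more opening than closing brackets.
\<close>

lemma balanced_factor_cases:
  assumes "balanced a" "balanced m" "a @ b = p @ bracket m @ s"
  shows "(\<exists>t. a = p @ bracket m @ t) \<or> (\<exists>q. b = q @ bracket m @ s)"
proof -
  consider (right) q where "b = q @ bracket m @ s"
    | (left) t where "a = p @ bracket m @ t"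
    | (straddle) us vs where "a = p @ us" "us @ vs = bracket m" "us \<noteq> []" "vs \<noteq> []"
    using assms(3) by (fastforce simp: append_eq_append_conv2)
  then show ?thesis
  proof cases
    case straddle
    then obtain us' vs' where "us = LB # us'" "vs = vs' @ [RB]"
      by (cases us; cases vs rule: rev_cases) (auto simp: bracket_def)
    then have "m = us' @ vs'" "a = p @ LB # us'"
      using straddle by (auto simp: bracket_def)
    from balancedD(1)[OF assms(2) this(1)] balancedD(2)[OF assms(1) this(2)]
    show ?thesis by simp
  qed blast+
qed

lemma nested_append:
  assumes "balanced a"
  shows "nested (a @ b) \<longleftrightarrow> nested a \<or> nested b"
proof
  assume "nested (a @ b)"
  then obtain p m s where "a @ b = p @ bracket (bracket m) @ s" "balanced m"
    by (auto simp: nested_def)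
  then show "nested a \<or> nested b"
    using balanced_factor_cases[OF assms balanced_bracket] unfolding nested_def by metis
next
  assume "nested a \<or> nested b"
  then show "nested (a @ b)" unfolding nested_def by (metis append.assoc)
qed

text \<open>
  An occurrence of \<open>\<lfloor>\<lfloor>m\<rfloor>\<rfloor>\<close> in \<open>\<lfloor>u\<rfloor>\<close> either starts at the first
  letter, and then uniqueness of the partner forces \<open>u = \<lfloor>m\<rfloor>\<close>, or lies inside \<open>u\<close>:
  it cannot reach the last letter, because that bracket is matched with the first one.
\<close>

lemma nested_bracket:
  assumes "balanced u"
  shows "nested (bracket u) \<longleftrightarrow> nested u \<or> (\<exists>m. balanced m \<and> u = bracket m)"
proof
  assume "nested (bracket u)"
  then obtain p m s where eq: "bracket u = p @ bracket (bracket m) @ s" and m: "balanced m"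
    by (auto simp: nested_def)
  show "nested u \<or> (\<exists>m. balanced m \<and> u = bracket m)"
  proof (cases p)
    case Nil
    then have "u = bracket m"
      using eq m bracket_append_inject[OF assms balanced_bracket, of m "[]" s] by simp
    with m show ?thesis by blast
  next
    case (Cons a p')
    then have p': "u @ [RB] = p' @ bracket (bracket m) @ s"
      using eq by (simp add: bracket_def)
    have "s \<noteq> []"
    proof
      assume "s = []"
      with p' have u: "u = p' @ LB # bracket m" by (simp add: bracket_def)
      from balancedD(2)[OF assms u] balanced_count[OF balanced_bracket[OF m]]
      show False by simp
    qed
    then obtain s' where "s = s' @ [RB]"
      using p' by (cases s rule: rev_cases) auto
    then have "u = p' @ bracket (bracket m) @ s'" using p' by simp
    with m show ?thesis by (auto simp: nested_def)
  qed
next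
  assume "nested u \<or> (\<exists>m. balanced m \<and> u = bracket m)"
  then show "nested (bracket u)"
  proof (elim disjE exE conjE)
    assume "nested u"
    then obtain p m s where "u = p @ bracket (bracket m) @ s" "balanced m"
      by (auto simp: nested_def)
    then have "bracket u = (LB # p) @ bracket (bracket m) @ (s @ [RB])"
      by (simp add: bracket_def)
    with \<open>balanced m\<close> show ?thesis unfolding nested_def by blast
  next
    fix m assume "balanced m" "u = bracket m"
    then show ?thesis unfolding nested_def by (metis append_Nil append_Nil2)
  qed
qed

section \<open>Generating functions of sets of Rota-Baxter words\<close>

abbreviation wt :: "word \<Rightarrow> nat" where
  "wt w \<equiv> count_list w LB"

text \<open>
  Among any two adjacent letters at least one is a bracket, so the number of brackets bounds the
  length, and only finitely many words share a degree. The additional summand for a leading \<open>x\<close>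
  makes the induction go through.
\<close>

lemma length_le_if_admissible:
  "successively admissible w \<Longrightarrow>
     length w \<le> 2 * (count_list w LB + count_list w RB) + (if w \<noteq> [] \<and> hd w = X then 1 else 0)"
proof (induction w)
  case (Cons a w)
  then show ?case
    by (cases a; cases w) (auto simp: admissible_def successively_Cons split: if_splits)
qed simp

lemma finite_rota_baxter_words:
  assumes "A \<subseteq> rota_baxter_words"
  shows "finite {w \<in> A. wt w = n}"
proof (rule finite_subset)
  show "{w \<in> A. wt w = n} \<subseteq> {w. set w \<subseteq> {X, LB, RB} \<and> length w \<le> 4 * n + 1}"
  proof safe
    fix w a assume "w \<in> A" "n = wt w"
    then show "length w \<le> 4 * wt w + 1"
      using length_le_if_admissible[of w] balanced_count[of w] assms
      by (fastforce simp: rota_baxter_words_alt split: if_splits)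
  qed (metis letter.exhaust)
qed (simp add: finite_lists_length_le)

text \<open>
  The weight of a word is its degree if the word is balanced. As \<open>card\<close> is zero on infinite sets,
  the coefficients are meaningful counts for subsets of \<open>rota_baxter_words\<close>, by the finiteness
  above.
\<close>

definition gen_fun :: "word set \<Rightarrow> real fps" where
  "gen_fun A = Abs_fps (\<lambda>n. real (card {w \<in> A. wt w = n}))"

lemma gen_fun_Un:
  assumes "A \<subseteq> rota_baxter_words" "B \<subseteq> rota_baxter_words" "A \<inter> B = {}"
  shows "gen_fun (A \<union> B) = gen_fun A + gen_fun B"
proof (rule fps_ext)
  fix n
  have "{w \<in> A \<union> B. wt w = n} = {w \<in> A. wt w = n} \<union> {w \<in> B. wt w = n}" by auto
  then show "gen_fun (A \<union> B) $ n = (gen_fun A + gen_fun B) $ n"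
    using assms finite_rota_baxter_words
    by (simp add: gen_fun_def, subst card_Un_disjoint) auto
qed

lemma gen_fun_Nil: "gen_fun {[]} = 1"
proof (rule fps_ext)
  fix n
  have "{w \<in> {[]}. wt w = n} = (if n = 0 then {[]} else {})" by auto
  then show "gen_fun {[]} $ n = 1 $ n" by (simp add: gen_fun_def)
qed

lemma gen_fun_image:
  assumes "inj_on f A" "\<And>w. w \<in> A \<Longrightarrow> wt (f w) = wt w"
  shows "gen_fun (f ` A) = gen_fun A"
proof (rule fps_ext)
  fix n
  have "{w \<in> f ` A. wt w = n} = f ` {w \<in> A. wt w = n}" using assms(2) by auto
  moreover have "inj_on f {w \<in> A. wt w = n}" using assms(1) by (rule inj_on_subset) auto
  ultimately show "gen_fun (f ` A) $ n = gen_fun A $ n"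
    by (simp add: gen_fun_def card_image)
qed

lemma gen_fun_image_Suc:
  assumes "inj_on f A" "\<And>w. w \<in> A \<Longrightarrow> wt (f w) = Suc (wt w)"
  shows "gen_fun (f ` A) = fps_X * gen_fun A"
proof (rule fps_ext)
  fix n
  show "gen_fun (f ` A) $ n = (fps_X * gen_fun A) $ n"
  proof (cases n)
    case 0
    then have "{w \<in> f ` A. wt w = n} = {}" using assms(2) by auto
    then have "card {w \<in> f ` A. wt w = n} = 0" by (simp only: card.empty)
    with 0 show ?thesis by (simp add: gen_fun_def)
  next
    case (Suc k)
    then have "{w \<in> f ` A. wt w = n} = f ` {w \<in> A. wt w = k}" using assms(2) by auto
    moreover have "inj_on f {w \<in> A. wt w = k}" using assms(1) by (rule inj_on_subset) auto
    ultimately show ?thesis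
      using Suc by (simp add: gen_fun_def card_image)
  qed
qed

text \<open>
  The product rule for generating functions: injectivity of \<open>f\<close> says that each word arises from
  a single pair, and the weights add up, so coefficients convolve.
\<close>

lemma gen_fun_times:
  assumes "A \<subseteq> rota_baxter_words" "B \<subseteq> rota_baxter_words"
    and "inj_on f (A \<times> B)" "\<And>u v. u \<in> A \<Longrightarrow> v \<in> B \<Longrightarrow> wt (f (u, v)) = wt u + wt v"
  shows "gen_fun (f ` (A \<times> B)) = gen_fun A * gen_fun B"
proof (rule fps_ext)
  fix n
  let ?S = "\<lambda>i. {u \<in> A. wt u = i} \<times> {v \<in> B. wt v = n - i}"
  have eq: "{w \<in> f ` (A \<times> B). wt w = n} = f ` (\<Union>i\<in>{0..n}. ?S i)"
    using assms(4) by (auto simp: image_iff)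
  have "inj_on f (\<Union>i\<in>{0..n}. ?S i)"
    using assms(3) by (rule inj_on_subset) auto
  then have "card {w \<in> f ` (A \<times> B). wt w = n} = card (\<Union>i\<in>{0..n}. ?S i)"
    unfolding eq by (rule card_image)
  also have "\<dots> = (\<Sum>i=0..n. card (?S i))"
    using assms(1,2) finite_rota_baxter_words
    by (intro card_UN_disjoint) auto
  finally show "gen_fun (f ` (A \<times> B)) $ n = (gen_fun A * gen_fun B) $ n"
    by (simp add: gen_fun_def fps_mult_nth card_cartesian_product)
qed

section \<open>Unambiguous decomposition\<close>

definition x_free_start :: "word set" where
  "x_free_start = {w \<in> rota_baxter_words. \<forall>v. w \<noteq> X # v}"

definition single_brackets :: "word set" where
  "single_brackets = {w \<in> rota_baxter_words. \<exists>u. balanced u \<and> w = bracket u}"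

lemma not_nested_X: "\<not> nested [X]"
  by (auto simp: nested_def bracket_def Cons_eq_append_conv)

lemma rota_baxter_Cons_X:
  "X # w \<in> rota_baxter_words \<longleftrightarrow> w \<in> x_free_start"
proof -
  have "nested (X # w) \<longleftrightarrow> nested w"
    using nested_append[OF balanced_X] not_nested_X by simp
  moreover have "(w = [] \<or> admissible X (hd w)) \<longleftrightarrow> (\<forall>v. w \<noteq> X # v)"
    by (cases w) (auto simp: admissible_def)
  ultimately show ?thesis
    by (auto simp: rota_baxter_words_alt x_free_start_def successively_Cons)
qed

text \<open>
  The new brackets violate a condition in just two cases: around \<open>u = []\<close> they form the factor
  \<open>\<lfloor>\<rfloor>\<close>, and around a single bracketed word they are immediately nested. Other forbidden
  factors cannot arise, as a balanced word neither starts with a closing nor ends with an opening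
  bracket.
\<close>

lemma rota_baxter_bracket:
  assumes "balanced u"
  shows "bracket u \<in> rota_baxter_words \<longleftrightarrow> u \<in> rota_baxter_words - {[]} - single_brackets"
proof -
  have "hd u \<noteq> RB \<and> last u \<noteq> LB" if "u \<noteq> []"
    using that balancedD(1)[OF assms, of "[hd u]" "tl u"]
      balancedD(2)[OF assms, of "butlast u" "[last u]"] by (auto split: if_splits)
  then have "successively admissible (bracket u) \<longleftrightarrow> successively admissible u \<and> u \<noteq> []"
    by (auto simp: bracket_def successively_Cons successively_append_iff admissible_def)
  then show ?thesis
    using nested_bracket[OF assms] assms balanced_bracket[OF assms]
    by (auto simp: rota_baxter_words_alt single_brackets_def)
qed

text \<open>
  What follows a closed bracket cannot start with an opening bracket by the ban on
  \<open>\<rfloor>\<lfloor>\<close>, nor with a closing one by balance. Every other condition can be checked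
  separately on the two parts.
\<close>

lemma rota_baxter_bracket_append:
  assumes "balanced u" "w \<noteq> []"
  shows "bracket u @ w \<in> rota_baxter_words \<longleftrightarrow>
    bracket u \<in> rota_baxter_words \<and> w \<in> rota_baxter_words \<and> hd w = X"
proof (cases "balanced w")
  case True
  have "hd w \<noteq> RB"
    using assms(2) balancedD(1)[OF True, of "[hd w]" "tl w"] by (auto split: if_splits)
  then have "admissible RB (hd w) \<longleftrightarrow> hd w = X"
    by (cases "hd w") (auto simp: admissible_def)
  then show ?thesis
    using True nested_append[OF balanced_bracket[OF assms(1)], of w] balanced_bracket[OF assms(1)]
      balanced_append[of "bracket u" w] assms(2)
    by (auto simp: rota_baxter_words_alt successively_append_iff) (auto simp: bracket_def)
next
  case False
  then show ?thesis
    using balanced_append_cancel[OF balanced_bracket[OF assms(1)]]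
    by (auto simp: rota_baxter_words_alt)
qed

lemma rota_baxter_words_eq: "rota_baxter_words = x_free_start \<union> (#) X ` x_free_start"
  using rota_baxter_Cons_X by (auto simp: x_free_start_def)

lemma single_brackets_eq:
  "single_brackets = bracket ` (rota_baxter_words - {[]} - single_brackets)"
  using rota_baxter_bracket by (auto simp: single_brackets_def rota_baxter_words_alt image_iff)

text \<open>
  A nonempty word of this kind starts with an opening bracket. Cutting behind its partner leaves
  a rest that is empty or starts with \<open>x\<close>.
\<close>

lemma x_free_start_eq:
  "x_free_start = {[]} \<union> single_brackets \<union>
     (\<lambda>(p, q). p @ X # q) ` (single_brackets \<times> x_free_start)" (is "_ = ?rhs")
proof (intro equalityI subsetI)
  fix w assume w: "w \<in> x_free_start"
  show "w \<in> ?rhs"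
  proof (cases w)
    case (Cons a w')
    have R: "w \<in> rota_baxter_words" and "a \<noteq> X"
      using w Cons by (auto simp: x_free_start_def)
    then have b: "balanced w" by (simp add: rota_baxter_words_alt)
    then have a: "w = LB # w'"
      using \<open>a \<noteq> X\<close> Cons balancedD(1)[OF b, of "[a]" w'] by (cases a) auto
    then obtain u v where "w' = u @ RB # v" "balanced u"
      using first_return[of w'] balancedD(2)[OF b, of "[]" w] by auto
    then have eq: "w = bracket u @ v" by (simp add: a bracket_def)
    show ?thesis
    proof (cases "v = []")
      case True
      then show ?thesis using eq R \<open>balanced u\<close> by (auto simp: single_brackets_def)
    next
      case False
      then have "bracket u \<in> rota_baxter_words" "v \<in> rota_baxter_words" "hd v = X"
        using rota_baxter_bracket_append[OF \<open>balanced u\<close>] R eq by auto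
      moreover from this False obtain q where "v = X # q" by (cases v) auto
      ultimately have "bracket u \<in> single_brackets" "q \<in> x_free_start" "w = bracket u @ X # q"
        using eq \<open>balanced u\<close> rota_baxter_Cons_X by (auto simp: single_brackets_def)
      then show ?thesis by force
    qed
  qed simp
next
  fix w assume "w \<in> ?rhs"
  then consider "w = []" | "w \<in> single_brackets"
    | u q where "balanced u" "bracket u \<in> rota_baxter_words" "q \<in> x_free_start" "w = bracket u @ X # q"
    by (auto simp: single_brackets_def)
  then show "w \<in> x_free_start"
  proof cases
    case 3
    then have "w \<in> rota_baxter_words"
      using rota_baxter_bracket_append[of u "X # q"] rota_baxter_Cons_X by simp
    then show ?thesis using 3 by (auto simp: x_free_start_def bracket_def)
  qed (auto simp: x_free_start_def single_brackets_def rota_baxter_words_alt nested_def bracket_def)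
qed

lemma wt_bracket [simp]: "wt (bracket u) = Suc (wt u)"
  by (simp add: bracket_def)

lemma inj_bracket: "inj bracket"
  by (auto simp: inj_def bracket_def)

lemma x_free_start_subset: "x_free_start \<subseteq> rota_baxter_words"
  and single_brackets_subset: "single_brackets \<subseteq> rota_baxter_words"
  by (auto simp: x_free_start_def single_brackets_def)

lemma Nil_in_rota_baxter_words: "[] \<in> rota_baxter_words"
  by (simp add: rota_baxter_words_def)

section \<open>Solving for the generating function\<close>

lemma gen_fun_rota_baxter: "gen_fun rota_baxter_words = 2 * gen_fun x_free_start"
proof -
  have "gen_fun rota_baxter_words = gen_fun (x_free_start \<union> (#) X ` x_free_start)"
    by (subst rota_baxter_words_eq) (rule refl)
  also have "\<dots> = gen_fun x_free_start + gen_fun ((#) X ` x_free_start)"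
    using rota_baxter_words_eq by (intro gen_fun_Un) (auto simp: x_free_start_def)
  also have "gen_fun ((#) X ` x_free_start) = gen_fun x_free_start"
    by (rule gen_fun_image) auto
  finally show ?thesis by simp
qed

lemma gen_fun_single_brackets:
  "gen_fun single_brackets = fps_X * (gen_fun rota_baxter_words - 1 - gen_fun single_brackets)"
proof -
  let ?D = "rota_baxter_words - {[]} - single_brackets"
  have "gen_fun single_brackets = gen_fun (bracket ` ?D)"
    by (subst single_brackets_eq) (rule refl)
  also have "\<dots> = fps_X * gen_fun ?D"
    using inj_bracket by (intro gen_fun_image_Suc) (auto intro: inj_on_subset)
  also have "gen_fun rota_baxter_words = gen_fun ({[]} \<union> (single_brackets \<union> ?D))"
    using Nil_in_rota_baxter_words single_brackets_subset
    by (intro arg_cong[where f = gen_fun]) auto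
  then have "gen_fun rota_baxter_words = 1 + (gen_fun single_brackets + gen_fun ?D)"
    using Nil_in_rota_baxter_words single_brackets_subset
    by (subst (asm) gen_fun_Un, (auto simp: single_brackets_def bracket_def)[3])
      (subst (asm) gen_fun_Un, auto simp: gen_fun_Nil)
  then have "gen_fun ?D = gen_fun rota_baxter_words - 1 - gen_fun single_brackets"
    by simp
  finally show ?thesis .
qed

lemma gen_fun_x_free_start:
  "gen_fun x_free_start = 1 + gen_fun single_brackets + gen_fun single_brackets * gen_fun x_free_start"
proof -
  let ?f = "\<lambda>(p, q). p @ X # q"
  let ?C = "?f ` (single_brackets \<times> x_free_start)"
  have unique: "p = p' \<and> v = v'"
    if "p \<in> single_brackets" "p' \<in> single_brackets" "p @ v = p' @ v'" for p p' v v'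
    using that bracket_append_inject unfolding single_brackets_def by blast
  have inj: "inj_on ?f (single_brackets \<times> x_free_start)"
  proof (rule inj_onI, clarify)
    fix p q p' q' assume "p \<in> single_brackets" "p' \<in> single_brackets" "p @ X # q = p' @ X # q'"
    from unique[OF this] show "p = p' \<and> q = q'" by simp
  qed
  have sub: "?C \<subseteq> rota_baxter_words"
    using x_free_start_eq x_free_start_subset by blast
  have disj: "single_brackets \<inter> ?C = {}"
  proof (rule ccontr)
    assume "single_brackets \<inter> ?C \<noteq> {}"
    then obtain p p' q where "p \<in> single_brackets" "p' \<in> single_brackets" "p @ [] = p' @ X # q"
      by auto
    from unique[OF this] show False by simp
  qed
  have "gen_fun x_free_start = gen_fun ({[]} \<union> (single_brackets \<union> ?C))"
    by (subst x_free_start_eq) (simp only: Un_assoc)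
  also have "\<dots> = gen_fun {[]} + gen_fun (single_brackets \<union> ?C)"
    using sub single_brackets_subset Nil_in_rota_baxter_words
    by (intro gen_fun_Un) (auto simp: single_brackets_def bracket_def)
  also have "gen_fun (single_brackets \<union> ?C) = gen_fun single_brackets + gen_fun ?C"
    using sub disj by (intro gen_fun_Un single_brackets_subset)
  also have "gen_fun ?C = gen_fun single_brackets * gen_fun x_free_start"
    by (rule gen_fun_times[OF single_brackets_subset x_free_start_subset inj]) simp
  finally show ?thesis by (simp add: gen_fun_Nil add.assoc)
qed

lemma gen_fun_x_free_start_quadratic:
  defines "Q \<equiv> gen_fun x_free_start"
  shows "Q = 1 + 2 * fps_X * Q\<^sup>2"
proof -
  define P where "P = gen_fun single_brackets"
  have Q: "Q = 1 + P + P * Q" and P: "P = fps_X * (2 * Q - 1 - P)"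
    using gen_fun_x_free_start gen_fun_single_brackets gen_fun_rota_baxter
    by (simp_all add: P_def Q_def)
  have P': "P * (1 + fps_X) = fps_X * (2 * Q - 1)"
    using P by (simp add: algebra_simps)
  have Q': "P * (1 + Q) = Q - 1"
    using Q by (simp add: algebra_simps)
  \<comment> \<open>Evaluating \<open>P (1 + z) (1 + Q)\<close> in two ways eliminates \<open>P\<close>.\<close>
  have "(Q - 1) * (1 + fps_X) = fps_X * (2 * Q - 1) * (1 + Q)"
    unfolding Q'[symmetric] P'[symmetric] by (simp add: mult_ac)
  then show ?thesis by (simp add: algebra_simps power2_eq_square)
qed

text \<open>
  Completing the square turns the equation into \<open>(1 - 4zQ)\<^sup>2 = 1 - 8z\<close>. Differentiating this for
  \<open>S = zQ\<close> gives \<open>(1 - 4S) S' = 1\<close>, and multiplying by \<open>1 - 4S\<close> turns it into the linear equation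
  \<open>(1 - 8z) S' = 1 - 4S\<close>. Comparing coefficients there gives a recurrence of order one.
\<close>

lemma fps_quadratic_recurrence:
  fixes Q :: "real fps"
  assumes "Q = 1 + 2 * fps_X * Q\<^sup>2"
  shows "(real n + 2) * Q $ Suc n = 4 * (2 * real n + 1) * Q $ n"
proof -
  define S where "S = fps_X * Q"
  have "S = fps_X + 2 * S\<^sup>2"
    unfolding S_def by (subst assms) (simp add: algebra_simps power2_eq_square)
  then have "S - 2 * S\<^sup>2 = fps_X"
    by (metis add_diff_cancel_right')
  moreover have "(1 - 4 * S)\<^sup>2 = 1 - 8 * (S - 2 * S\<^sup>2)"
    by (simp add: algebra_simps power2_eq_square)
  ultimately have sq: "(1 - 4 * S)\<^sup>2 = 1 - 8 * fps_X"
    by simp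
  then have "fps_deriv ((1 - 4 * S)\<^sup>2) = fps_deriv (1 - 8 * fps_X)"
    by simp
  then have "8 * ((1 - 4 * S) * fps_deriv S) = 8 * 1"
    by (simp add: power2_eq_square algebra_simps)
  then have "(1 - 4 * S) * fps_deriv S = 1"
    unfolding mult_cancel_left by simp
  then have "(1 - 4 * S)\<^sup>2 * fps_deriv S = 1 - 4 * S"
    by (simp add: power2_eq_square mult.assoc)
  then have "(1 - 8 * fps_X) * fps_deriv S = 1 - 4 * S"
    unfolding sq .
  then have "fps_deriv S = 1 - 4 * S + 8 * (fps_X * fps_deriv S)"
    by (simp add: algebra_simps)
  from arg_cong[OF this, of "\<lambda>f. f $ Suc n"] show ?thesis
    by (simp add: S_def numeral_fps_const algebra_simps)
qed

text \<open>
  The central binomial coefficients satisfy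
  \<open>(n + 1) (2n + 2 choose n + 1) = 2 (2n + 1) (2n choose n)\<close>, so that \<open>2\<^sup>n C\<^sub>n\<close> obeys the
  recurrence for the coefficients of \<open>Q\<close>.
\<close>

lemma x_free_start_count:
  "gen_fun x_free_start $ n = 2 ^ n * (1 / (real n + 1) * real ((2 * n) choose n))"
proof (induction n)
  case 0
  show ?case
    by (subst gen_fun_x_free_start_quadratic) simp
next
  case (Suc n)
  let ?c = "\<lambda>n. real ((2 * n) choose n)"
  have c: "(real n + 1) * ?c (Suc n) = 2 * (2 * real n + 1) * ?c n"
  proof -
    have "Suc n * (Suc (2 * n) choose n) = Suc n * (Suc (2 * n) choose Suc n)"
      using binomial_symmetric[of n "Suc (2 * n)"] by simp
    also have "\<dots> = Suc (2 * n) * ((2 * n) choose n)"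
      by (rule Suc_times_binomial)
    finally have half: "Suc n * (Suc (2 * n) choose n) = Suc (2 * n) * ((2 * n) choose n)" .
    have "Suc n * (2 * Suc n choose Suc n) = Suc n * (2 * (Suc (2 * n) choose n))"
      using Suc_times_binomial[of n "Suc (2 * n)"] by (simp del: binomial_Suc_Suc)
    also have "\<dots> = 2 * (Suc (2 * n) * ((2 * n) choose n))"
      unfolding half[symmetric] by (rule mult.left_commute)
    finally have "Suc n * (2 * Suc n choose Suc n) = 2 * (Suc (2 * n) * ((2 * n) choose n))" .
    from arg_cong[OF this, of real] show ?thesis by (simp add: algebra_simps)
  qed
  have "(real n + 2) * gen_fun x_free_start $ Suc n =
      4 * (2 * real n + 1) * (2 ^ n * (1 / (real n + 1) * ?c n))"
    using fps_quadratic_recurrence[OF gen_fun_x_free_start_quadratic, of n] unfolding Suc .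
  also have "\<dots> = 2 ^ Suc n * (1 / (real n + 1)) * (2 * (2 * real n + 1) * ?c n)"
    by simp
  also have "\<dots> = 2 ^ Suc n * ?c (Suc n)"
    unfolding c[symmetric] by simp
  finally show ?case
    by (simp add: field_simps)
qed

theorem corollary3p2:
  fixes n :: nat
  shows "real (card {w \<in> rota_baxter_words. degree w = n}) =
           2 ^ (n + 1) * (1 / (real n + 1) * real ((2 * n) choose n))"
proof -
  have "{w \<in> rota_baxter_words. degree w = n} = {w \<in> rota_baxter_words. wt w = n}"
    using degree_eq_count by (auto simp: rota_baxter_words_alt)
  then have "real (card {w \<in> rota_baxter_words. degree w = n}) = gen_fun rota_baxter_words $ n"
    by (simp add: gen_fun_def)
  also have "\<dots> = 2 * gen_fun x_free_start $ n"
    by (simp add: gen_fun_rota_baxter numeral_fps_const)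
  finally show ?thesis by (simp add: x_free_start_count)
qed

end
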